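(* Let $k$ and $\ell$ be positive integers with $k\ge 3$, $0<\ell<k$ and $\ell\neq\frac{k}{2}$. Let $n$ be a positive integer. Then $$f_{k,\ell}(n)=\begin{cases}\Big(\sum_{j\in\mathbb{Z}\setminus\{0\}}(-1)^{j-1}f_{k,\ell}(n-M_{k,\ell}(j))\Big)+(-1)^{i-1}M_{k,\ell}(i) & \text{if } n=M_{k,\ell}(i)\text{ for some } i\in\mathbb{Z},\\[4pt] \sum_{j\in\mathbb{Z}\setminus\{0\}}(-1)^{j-1}f_{k,\ell}(n-M_{k,\ell}(j)) & \text{otherwise.}\end{cases}$$
   Context: For $j\in\mathbb{Z}$, $M_{k,\ell}(j)=\frac{k}{2}j(j-1)+\ell j$; under the assumptions on $k,\ell$ these values are pairwise distinct, so $i$ is unique when it exists. $\overline{\mathrm{J}}_{k,\ell}$ is the set of all positive integers congruent to $0$, $\ell$ or $-\ell$ modulo $k$. For a positive integer $n$, $f_{k,\ell}(n)=\sum_{d\mid n,\ d\in\overline{\mathrm{J}}_{k,\ell}}d$ is the sum of the positive divisors of $n$ that lie in $\overline{\mathrm{J}}_{k,\ell}$; and $f_{k,\ell}(n)=0$ for every integer $n\le 0$. Thus the sums are finite. *)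

theory Defs
  imports "HOL-Analysis.Infinite_Sum" "HOL-Number_Theory.Cong"
begin

text \<open>Since \<open>j * (j - 1)\<close> is even, the integer division is exact; see \<open>of_int_M\<close>.\<close>

definition M :: "int \<Rightarrow> int \<Rightarrow> int \<Rightarrow> int" where
  "M k l j = k * (j * (j - 1)) div 2 + l * j"

definition Jbar :: "int \<Rightarrow> int \<Rightarrow> int set" where
  "Jbar k l = {d. d > 0 \<and> ([d = 0] (mod k) \<or> [d = l] (mod k) \<or> [d = - l] (mod k))}"

definition f :: "int \<Rightarrow> int \<Rightarrow> int \<Rightarrow> int" where
  "f k l n = (if n > 0 then \<Sum>d | d dvd n \<and> d \<in> Jbar k l. d else 0)"

text \<open>The sign \<open>(-1) powi (j - 1)\<close> for an integer \<open>j\<close>; integer exponents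
  (\<^const>\<open>power_int\<close>) are not available for the base type \<^typ>\<open>int\<close>, hence the
  absolute value, which does not change the parity; see \<open>of_int_alt_sign\<close>.\<close>

definition alt_sign :: "int \<Rightarrow> int" where
  "alt_sign j = (-1) ^ nat \<bar>j - 1\<bar>"

lemma two_M: "2 * M k l j = k * (j * (j - 1)) + 2 * (l * j)"
proof -
  have "even (k * (j * (j - 1)))" by simp
  then show ?thesis unfolding M_def by (simp add: distrib_left)
qed

lemma of_int_M: "real_of_int (M k l j) = k / 2 * j * (j - 1) + l * j"
proof -
  have "real_of_int (2 * M k l j) = real_of_int (k * (j * (j - 1)) + 2 * (l * j))"
    by (simp only: two_M)
  then show ?thesis by (simp add: field_simps)
qed

lemma of_int_alt_sign: "real_of_int (alt_sign j) = (-1) powi (j - 1)"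
proof -
  have "real_of_int (alt_sign j) = (if even (j - 1) then 1 else -1)"
    unfolding alt_sign_def by (auto simp: even_nat_iff)
  also have "\<dots> = (-1) powi (j - 1)"
    by (simp add: power_int_minus_left)
  finally show ?thesis .
qed

lemma M_inj:
  assumes "0 < l" "l < k" "2 * l \<noteq> k"
  shows "inj (M k l)"
proof (rule injI, rule ccontr)
  fix i j assume eq: "M k l i = M k l j" and ne: "i \<noteq> j"
  have "k * (i * (i - 1)) + 2 * (l * i) = k * (j * (j - 1)) + 2 * (l * j)"
    using eq two_M[of k l i] two_M[of k l j] by simp
  then have "(i - j) * (k * (i + j - 1) + 2 * l) = 0" by (simp add: algebra_simps)
  with ne have "k * (i + j - 1) + 2 * l = 0" by (metis mult_eq_0_iff right_minus_eq)
  then have *: "2 * l = k * (1 - i - j)" by (simp add: algebra_simps)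
  define t where "t = 1 - i - j"
  with * have kt: "2 * l = k * t" by simp
  then have "0 < k * t" "k * t < k * 2" using assms by linarith+
  then have "0 < t" "t < 2"
    using assms by (auto simp: zero_less_mult_iff mult_less_cancel_left)
  then have "t = 1" by simp
  with kt assms show False by simp
qed

lemma M_ge:
  assumes "0 < l" "l < k"
  shows "\<bar>j\<bar> \<le> 2 * M k l j"
proof (cases "j \<ge> 1")
  case True
  have "0 \<le> k * (j * (j - 1))" using True assms by simp
  moreover have "1 * j \<le> l * j" using True assms by (intro mult_right_mono) auto
  ultimately show ?thesis using two_M[of k l j] True by linarith
next
  case False
  then have "j \<le> 0" by simp
  have "2 * M k l j = (- j) * (k * (1 - j) - 2 * l)"
    by (simp add: two_M algebra_simps)
  moreover have "(- j) * 1 \<le> (- j) * (k * (1 - j) - 2 * l)" if "j \<le> -1"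
  proof (rule mult_left_mono)
    have "k * 2 \<le> k * (1 - j)" using that assms by (intro mult_left_mono) auto
    then show "1 \<le> k * (1 - j) - 2 * l" using assms by linarith
  qed (use that in simp)
  ultimately show ?thesis using \<open>j \<le> 0\<close> by (cases "j = 0") auto
qed

lemma finite_support:
  assumes "0 < l" "l < k"
  shows "finite {j. f k l (n - M k l j) \<noteq> 0}"
proof (rule finite_subset)
  show "{j. f k l (n - M k l j) \<noteq> 0} \<subseteq> {- (2 * n)..2 * n}"
  proof
    fix j assume "j \<in> {j. f k l (n - M k l j) \<noteq> 0}"
    then have "M k l j < n" by (auto simp: f_def split: if_splits)
    then show "j \<in> {- (2 * n)..2 * n}" using M_ge[OF assms, of j] by auto
  qed
qed simp

text \<open>Infinite sums over \<^typ>\<open>int\<close> are taken in the discrete topology; by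
  \<open>finite_support\<close> the sum over all nonzero \<open>j\<close> is the finite sum of its nonzero terms.\<close>

lemma infsum_eq_sum:
  assumes "0 < l" "l < k"
  shows "(\<Sum>\<^sub>\<infinity>j\<in>UNIV - {0}. alt_sign j * f k l (n - M k l j)) =
    (\<Sum>j | j \<noteq> 0 \<and> f k l (n - M k l j) \<noteq> 0. alt_sign j * f k l (n - M k l j))"
proof -
  let ?A = "{j. j \<noteq> 0 \<and> f k l (n - M k l j) \<noteq> 0}"
  have "finite ?A" by (rule finite_subset[OF _ finite_support[OF assms, of n]]) auto
  moreover have "(\<Sum>\<^sub>\<infinity>j\<in>UNIV - {0}. alt_sign j * f k l (n - M k l j))
      = (\<Sum>\<^sub>\<infinity>j\<in>?A. alt_sign j * f k l (n - M k l j))"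
    by (rule infsum_cong_neutral) auto
  ultimately show ?thesis by simp
qed

end

theory Submission
  imports Defs "HOL-Computational_Algebra.Formal_Power_Series"
begin

text \<open>
  The recurrence is the logarithmic derivative of the Jacobi triple product. The residues
  \<open>0\<close>, \<open>l\<close>, \<open>-l\<close> modulo \<open>k\<close> are distinct, so the triple product identity with base \<open>X^k\<close> and
  variable \<open>X^l\<close> reads
  \<open>A = (\<Prod>d\<in>Jbar. 1 - X^d) = (\<Sum>j\<in>\<int>. (-1)^j * X^(M j))\<close>.
  On the other hand \<open>X * A' = - A * F\<close>, where \<open>F\<close> is the generating function of \<open>f\<close>. The
  coefficient of \<open>X^n\<close> in this equation is
  \<open>n * A$n = - (\<Sum>j. (-1)^j * f (n - M j))\<close>,
  and the claim follows on isolating the term \<open>j = 0\<close>, because \<open>A$n\<close> is \<open>(-1)^i\<close> if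
  \<open>n = M i\<close> and \<open>0\<close> if \<open>n\<close> is not a value of \<open>M\<close>.

  Infinite products are avoided. Only coefficients up to \<open>n\<close> matter, so \<open>A\<close> may be replaced by
  the finite product over the elements of \<open>Jbar\<close> up to \<open>k * m\<close> for \<open>m = 3 * n\<close>. Cauchy's finite
  form of the triple product (\<open>finite_triple_product\<close>), which follows by induction from the two
  \<open>q\<close>-Pascal rules, expands the factors with exponents \<open>l\<close> and \<open>-l\<close> modulo \<open>k\<close>, with a Gaussian
  binomial coefficient attached to each \<open>(-1)^j * X^(M j)\<close>. Multiplication by the remaining factors, whose exponents
  are the multiples of \<open>k\<close>, turns the binomial coefficient at each \<open>j\<close> with \<open>M j \<le> n\<close> into a series
  congruent to \<open>1\<close> modulo \<open>X^(n + 1)\<close> (\<open>qfact_qbinomial_cong\<close>), which determines the coefficients of \<open>A\<close> up to \<open>n\<close>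
  (\<open>nth_prod_Jbar_upto\<close>).
\<close>

unbundle fps_syntax

section \<open>Gaussian binomial coefficients\<close>

text \<open>The \<open>q\<close>-Pochhammer symbol \<open>(q; q)\<^sub>m\<close> at \<open>q = X^k\<close>. The coefficients
  are rational because \<^const>\<open>inverse\<close> on power series needs a coefficient type with inverses.\<close>

definition qfact :: "nat \<Rightarrow> nat \<Rightarrow> rat fps" where
  "qfact k m = (\<Prod>i<m. 1 - fps_X ^ (k * Suc i))"

text \<open>The Gaussian binomial coefficient \<open>N\<close> over \<open>i\<close> at \<open>q = X^k\<close>, extended by \<open>0\<close> to \<open>i > N\<close>.\<close>

definition qbinomial :: "nat \<Rightarrow> nat \<Rightarrow> nat \<Rightarrow> rat fps" where
  "qbinomial k N i = (if i \<le> N then qfact k N * inverse (qfact k i) * inverse (qfact k (N - i)) else 0)"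

lemma qfact_0 [simp]: "qfact k 0 = 1"
  by (simp add: qfact_def)

lemma qfact_Suc: "qfact k (Suc m) = qfact k m * (1 - fps_X ^ (k * Suc m))"
  by (simp add: qfact_def mult.commute)

lemma qfact_nth_0 [simp]: "k > 0 \<Longrightarrow> qfact k m $ 0 = 1"
  by (induction m) (simp_all add: qfact_Suc)

lemma qfact_inverse: "k > 0 \<Longrightarrow> qfact k m * inverse (qfact k m) = 1"
  by (subst mult.commute) (rule inverse_mult_eq_1, simp)

lemma inverse_qfact:
  assumes "k > 0"
  shows "inverse (qfact k m) = inverse (qfact k (Suc m)) * (1 - fps_X ^ (k * Suc m))"
proof -
  have "inverse (qfact k m) = inverse (qfact k m) * (qfact k (Suc m) * inverse (qfact k (Suc m)))"
    using qfact_inverse[OF assms, of "Suc m"] by simp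
  also have "\<dots> = (qfact k m * inverse (qfact k m)) * (inverse (qfact k (Suc m)) * (1 - fps_X ^ (k * Suc m)))"
    by (simp only: qfact_Suc[of k m] ac_simps)
  finally show ?thesis using qfact_inverse[OF assms, of m] by simp
qed

lemma qbinomial_0 [simp]: "k > 0 \<Longrightarrow> qbinomial k N 0 = 1"
  by (simp add: qbinomial_def qfact_inverse)

lemma qbinomial_self [simp]: "k > 0 \<Longrightarrow> qbinomial k N N = 1"
  by (simp add: qbinomial_def qfact_inverse)

lemma qbinomial_eq_0 [simp]: "N < i \<Longrightarrow> qbinomial k N i = 0"
  by (simp add: qbinomial_def)

text \<open>The two \<open>q\<close>-analogues of Pascal's rule.\<close>

lemma qbinomial_Suc_Suc:
  assumes "k > 0" "i \<le> N"
  shows "qbinomial k (Suc N) (Suc i) = qbinomial k N (Suc i) + fps_X ^ (k * (N - i)) * qbinomial k N i"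
proof (cases "i = N")
  case False
  with assms obtain p where N: "N = i + Suc p"
    by (metis add_Suc_right le_neq_implies_less less_imp_Suc_add)
  define A B C where "A = qfact k N" and "B = inverse (qfact k (Suc i))"
    and "C = inverse (qfact k (Suc p))"
  have "qbinomial k (Suc N) (Suc i) = A * (1 - fps_X ^ (k * Suc N)) * B * C"
    by (simp add: qbinomial_def A_def B_def C_def N qfact_Suc)
  moreover have "qbinomial k N (Suc i) = A * B * (C * (1 - fps_X ^ (k * Suc p)))"
    using inverse_qfact[OF assms(1), of p] by (simp add: qbinomial_def A_def B_def C_def N)
  moreover have "qbinomial k N i = A * (B * (1 - fps_X ^ (k * Suc i))) * C"
    using inverse_qfact[OF assms(1), of i] by (simp add: qbinomial_def A_def B_def C_def N)
  moreover have "(fps_X :: rat fps) ^ (k * Suc N) = fps_X ^ (k * Suc p) * fps_X ^ (k * Suc i)"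
    by (simp add: N power_add [symmetric] algebra_simps)
  moreover have "N - i = Suc p" by (simp add: N)
  ultimately show ?thesis by (simp only:) (simp only: algebra_simps mult_1_left mult_1_right)
qed (use assms in simp)

lemma qbinomial_symmetric: "i \<le> N \<Longrightarrow> qbinomial k N (N - i) = qbinomial k N i"
  by (simp add: qbinomial_def ac_simps)

lemma qbinomial_Suc_Suc':
  assumes "k > 0" "i \<le> N"
  shows "qbinomial k (Suc N) (Suc i) = qbinomial k N i + fps_X ^ (k * Suc i) * qbinomial k N (Suc i)"
proof (cases "i = N")
  case False
  with assms obtain p where N: "N = i + Suc p"
    by (metis add_Suc_right le_neq_implies_less less_imp_Suc_add)
  have "qbinomial k (Suc N) (Suc i) = qbinomial k (Suc N) (Suc p)"
    using qbinomial_symmetric[of "Suc i" "Suc N" k] by (simp add: N)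
  also have "\<dots> = qbinomial k N (Suc p) + fps_X ^ (k * (N - p)) * qbinomial k N p"
    using assms by (intro qbinomial_Suc_Suc) (simp_all add: N)
  also have "qbinomial k N (Suc p) = qbinomial k N i"
    using qbinomial_symmetric[of i N k] by (simp add: N)
  also have "qbinomial k N p = qbinomial k N (Suc i)"
    using qbinomial_symmetric[of "Suc i" N k] by (simp add: N)
  finally show ?thesis by (simp add: N)
qed (use assms in simp)

lemma qfact_cong:
  assumes "k > 0" "n \<le> m"
  shows "fps_X ^ Suc n dvd qfact k m - qfact k n"
  using assms(2)
proof (induction m rule: dec_induct)
  case (step m)
  have "fps_X ^ Suc n dvd (fps_X :: rat fps) ^ (k * Suc m)"
    using step(1) assms(1) by (intro le_imp_power_dvd) (cases k, auto)
  then have "fps_X ^ Suc n dvd (qfact k m - qfact k n) - qfact k m * fps_X ^ (k * Suc m)"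
    by (intro dvd_diff[OF step.IH] dvd_mult)
  also have "(qfact k m - qfact k n) - qfact k m * fps_X ^ (k * Suc m) = qfact k (Suc m) - qfact k n"
    by (simp only: qfact_Suc right_diff_distrib mult_1_right) simp
  finally show ?case .
qed simp

text \<open>Near its middle, the row \<open>2 * m\<close> of Gaussian binomials agrees with \<open>1 / (q; q)\<^sub>m\<close> to high
  order: the four \<open>q\<close>-Pochhammer symbols that make up the product below have index at least
  \<open>n\<close>, hence are congruent to each other modulo \<open>X^(n + 1)\<close>.\<close>

lemma qfact_qbinomial_cong:
  assumes "k > 0" "n \<le> i" "n + i \<le> 2 * m" "n \<le> m"
  shows "fps_X ^ Suc n dvd qfact k m * qbinomial k (2 * m) i - 1"
proof -
  define D where "D = (fps_X :: rat fps) ^ Suc n"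
  define r where "r = qfact k n"
  define A B C E where "A = qfact k m" and "B = qfact k (2 * m)"
    and "C = qfact k i" and "E = qfact k (2 * m - i)"
  have *: "D dvd A - r" "D dvd B - r" "D dvd C - r" "D dvd E - r"
    unfolding D_def A_def B_def C_def E_def r_def
    by (rule qfact_cong; use assms in linarith)+
  have "A * B - C * E = (A - r) * B + r * (B - r) - ((C - r) * E + r * (E - r))"
    by (simp add: algebra_simps)
  then have "D dvd A * B - C * E"
    using * by (metis dvd_add dvd_diff dvd_mult dvd_mult2)
  then have "D dvd (A * B - C * E) * (inverse C * inverse E)" by (rule dvd_mult2)
  also have "(A * B - C * E) * (inverse C * inverse E)
      = A * (B * inverse C * inverse E) - (C * inverse C) * (E * inverse E)"
    by (simp only: algebra_simps)
  also have "\<dots> = A * qbinomial k (2 * m) i - 1"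
    using assms by (simp add: qbinomial_def B_def C_def E_def qfact_inverse)
  finally show ?thesis by (simp add: D_def A_def)
qed

section \<open>A finite form of the Jacobi triple product\<close>

lemma M_nonneg: "0 < l \<Longrightarrow> l < k \<Longrightarrow> 0 \<le> M k l j"
  using M_ge[of l k j] by linarith

lemma M_add_1: "M k l (j + 1) = M k l j + k * j + l"
  using two_M[of k l "j + 1"] two_M[of k l j] by (simp add: algebra_simps)

lemma alt_sign_eq: "alt_sign j = (if even j then - 1 else 1)"
  by (auto simp: alt_sign_def even_nat_iff)

lemma alt_sign_add_1: "alt_sign (j + 1) = - alt_sign j"
  by (simp add: alt_sign_eq)

text \<open>The term \<open>(-1)^j * X^(M j)\<close> of the theta series. The sign is the negative of
  \<^const>\<open>alt_sign\<close>, whose exponent is \<open>j - 1\<close>; truncation by \<^const>\<open>nat\<close> is harmless by \<open>M_nonneg\<close>.\<close>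

definition theta :: "nat \<Rightarrow> nat \<Rightarrow> int \<Rightarrow> rat fps" where
  "theta k l j = of_int (- alt_sign j) * fps_X ^ nat (M (int k) (int l) j)"

text \<open>Multiplication by a further factor of the triple product shifts the index of \<^const>\<open>theta\<close>
  by one. The remaining power of \<open>X^k\<close> is the one that occurs in the matching
  \<open>q\<close>-Pascal rule.\<close>

lemma theta_mult_right:
  assumes "0 < l" "l < k" "i \<le> a + b"
  shows "theta k l (int i - int b) * fps_X ^ (k * a + l)
       = - (theta k l (int (Suc i) - int b) * fps_X ^ (k * (a + b - i)))"
proof -
  define j where "j = int i - int b"
  have j': "int (Suc i) - int b = j + 1" by (simp add: j_def)
  have "int (nat (M k l j) + (k * a + l)) = int (nat (M k l (j + 1)) + k * (a + b - i))"
  proof -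
    have "int (k * (a + b - i)) = int k * int a - int k * j"
      by (simp only: of_nat_mult of_nat_diff[OF assms(3)] of_nat_add) (simp add: j_def algebra_simps)
    then show ?thesis
      using assms M_nonneg[of l k j] M_nonneg[of l k "j + 1"] M_add_1[of k l j] by simp
  qed
  then have "nat (M k l j) + (k * a + l) = nat (M k l (j + 1)) + k * (a + b - i)"
    by (simp only: of_nat_eq_iff)
  then show ?thesis
    unfolding theta_def j' j_def[symmetric]
    by (simp add: alt_sign_add_1 mult.assoc power_add [symmetric] del: of_nat_add of_nat_mult)
qed

lemma theta_mult_left:
  assumes "0 < l" "l < k"
  shows "theta k l (int i - int b) * fps_X ^ (k * Suc b - l)
       = - (theta k l (int i - int (Suc b)) * fps_X ^ (k * i))"
proof -
  define j where "j = int i - int (Suc b)"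
  have j': "int i - int b = j + 1" by (simp add: j_def)
  have "int (nat (M k l (j + 1)) + (k * Suc b - l)) = int (nat (M k l j) + k * i)"
  proof -
    have "int (k * Suc b - l) = int k * int (Suc b) - int l"
      using assms by (simp add: of_nat_diff distrib_left)
    moreover have "int k * int i = int k * int (Suc b) + int k * j"
      by (simp add: j_def algebra_simps)
    ultimately show ?thesis
      using assms M_nonneg[of l k j] M_nonneg[of l k "j + 1"] M_add_1[of k l j]
      by (simp del: of_nat_Suc mult_Suc_right)
  qed
  then have "nat (M k l (j + 1)) + (k * Suc b - l) = nat (M k l j) + k * i"
    by (simp only: of_nat_eq_iff)
  then show ?thesis
    unfolding theta_def j' j_def[symmetric]
    by (simp add: alt_sign_add_1 mult.assoc power_add [symmetric] del: of_nat_add of_nat_mult)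
qed

lemma triple_product_right:
  assumes "0 < l" "l < k"
  shows "(\<Sum>i\<le>a + b. theta k l (int i - int b) * qbinomial k (a + b) i) * (1 - fps_X ^ (k * a + l))
       = (\<Sum>i\<le>Suc a + b. theta k l (int i - int b) * qbinomial k (Suc a + b) i)"
proof -
  let ?N = "a + b" and ?t = "\<lambda>i. theta k l (int i - int b)"
  have "(\<Sum>i\<le>Suc a + b. ?t i * qbinomial k (Suc a + b) i)
      = ?t 0 + (\<Sum>i\<le>?N. ?t (Suc i) * qbinomial k (Suc ?N) (Suc i))"
    using assms by (simp add: sum.atMost_Suc_shift del: sum.atMost_Suc)
  also have "(\<Sum>i\<le>?N. ?t (Suc i) * qbinomial k (Suc ?N) (Suc i))
      = (\<Sum>i\<le>?N. ?t (Suc i) * qbinomial k ?N (Suc i) - ?t i * qbinomial k ?N i * fps_X ^ (k * a + l))"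
  proof (rule sum.cong)
    fix i assume "i \<in> {..?N}"
    then have i: "i \<le> ?N" by simp
    have "?t i * qbinomial k ?N i * fps_X ^ (k * a + l) = ?t i * fps_X ^ (k * a + l) * qbinomial k ?N i"
      by (simp only: ac_simps)
    also have "\<dots> = - (?t (Suc i) * (fps_X ^ (k * (?N - i)) * qbinomial k ?N i))"
      by (subst theta_mult_right[OF assms i]) (simp add: mult.assoc)
    finally show "?t (Suc i) * qbinomial k (Suc ?N) (Suc i)
        = ?t (Suc i) * qbinomial k ?N (Suc i) - ?t i * qbinomial k ?N i * fps_X ^ (k * a + l)"
      using assms i by (simp add: qbinomial_Suc_Suc distrib_left del: of_nat_Suc)
  qed simp
  also have "\<dots> = (\<Sum>i\<le>?N. ?t (Suc i) * qbinomial k ?N (Suc i))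
      - (\<Sum>i\<le>?N. ?t i * qbinomial k ?N i) * fps_X ^ (k * a + l)"
    by (simp add: sum_subtractf sum_distrib_right)
  also have "?t 0 + \<dots> = (\<Sum>i\<le>Suc ?N. ?t i * qbinomial k ?N i)
      - (\<Sum>i\<le>?N. ?t i * qbinomial k ?N i) * fps_X ^ (k * a + l)"
    using assms by (simp add: sum.atMost_Suc_shift del: sum.atMost_Suc)
  finally show ?thesis by (simp add: right_diff_distrib)
qed

lemma triple_product_left:
  assumes "0 < l" "l < k"
  shows "(\<Sum>i\<le>a + b. theta k l (int i - int b) * qbinomial k (a + b) i) * (1 - fps_X ^ (k * Suc b - l))
       = (\<Sum>i\<le>a + Suc b. theta k l (int i - int (Suc b)) * qbinomial k (a + Suc b) i)"
proof -
  let ?N = "a + b" and ?t = "\<lambda>i. theta k l (int i - int b)"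
    and ?u = "\<lambda>i. theta k l (int i - int (Suc b))" and ?Y = "fps_X ^ (k * Suc b - l) :: rat fps"
  have ut: "?u (Suc i) = ?t i" for i by simp
  have tY: "?t i * qbinomial k ?N i * ?Y = - (?u i * (fps_X ^ (k * i) * qbinomial k ?N i))" for i
  proof -
    have "?t i * qbinomial k ?N i * ?Y = ?t i * ?Y * qbinomial k ?N i"
      by (simp only: ac_simps)
    then show ?thesis
      by (subst (asm) theta_mult_left[OF assms]) (simp add: mult.assoc)
  qed
  have "(\<Sum>i\<le>a + Suc b. ?u i * qbinomial k (a + Suc b) i)
      = ?u 0 + (\<Sum>i\<le>?N. ?u (Suc i) * qbinomial k (Suc ?N) (Suc i))"
    using assms by (simp add: sum.atMost_Suc_shift del: sum.atMost_Suc)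
  also have "(\<Sum>i\<le>?N. ?u (Suc i) * qbinomial k (Suc ?N) (Suc i))
      = (\<Sum>i\<le>?N. ?t i * qbinomial k ?N i + ?u (Suc i) * (fps_X ^ (k * Suc i) * qbinomial k ?N (Suc i)))"
    using assms by (intro sum.cong refl)
      (simp only: qbinomial_Suc_Suc' distrib_left ut atMost_iff)
  also have "\<dots> = (\<Sum>i\<le>?N. ?t i * qbinomial k ?N i)
      + (\<Sum>i\<le>?N. ?u (Suc i) * (fps_X ^ (k * Suc i) * qbinomial k ?N (Suc i)))"
    by (rule sum.distrib)
  also have "?u 0 + \<dots> = (\<Sum>i\<le>?N. ?t i * qbinomial k ?N i)
      + (\<Sum>i\<le>Suc ?N. ?u i * (fps_X ^ (k * i) * qbinomial k ?N i))"
    using assms by (subst sum.atMost_Suc_shift) (simp add: add_ac)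
  also have "(\<Sum>i\<le>Suc ?N. ?u i * (fps_X ^ (k * i) * qbinomial k ?N i))
      = - ((\<Sum>i\<le>?N. ?t i * qbinomial k ?N i) * ?Y)"
    by (simp only: sum.atMost_Suc sum_distrib_right tY sum_negf minus_minus qbinomial_eq_0 lessI
        mult_zero_right add_0_right)
  finally show ?thesis by (simp add: right_diff_distrib)
qed

text \<open>Cauchy's finite form of the Jacobi triple product at \<open>q = X^k\<close> and \<open>z = X^l\<close>. The summation
  index is \<open>j = i - b\<close>, which runs from \<open>-b\<close> to \<open>a\<close>.\<close>

theorem finite_triple_product:
  assumes "0 < l" "l < k"
  shows "(\<Prod>i<a. 1 - fps_X ^ (k * i + l)) * (\<Prod>i<b. 1 - fps_X ^ (k * Suc i - l))
       = (\<Sum>i\<le>a + b. theta k l (int i - int b) * qbinomial k (a + b) i)"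
proof (induction b)
  case 0
  show ?case
  proof (induction a)
    case 0
    show ?case using assms by (simp add: theta_def M_def alt_sign_eq)
  next
    case (Suc a)
    have "(\<Prod>i<Suc a. 1 - fps_X ^ (k * i + l)) * (\<Prod>i<0. 1 - fps_X ^ (k * Suc i - l))
       = ((\<Prod>i<a. 1 - fps_X ^ (k * i + l)) * (\<Prod>i<0. 1 - fps_X ^ (k * Suc i - l)))
           * (1 - fps_X ^ (k * a + l) :: rat fps)"
      by (simp only: prod.lessThan_Suc ac_simps)
    then show ?case by (simp only: Suc.IH triple_product_right[OF assms])
  qed
next
  case (Suc b)
  have "(\<Prod>i<a. 1 - fps_X ^ (k * i + l)) * (\<Prod>i<Suc b. 1 - fps_X ^ (k * Suc i - l))
     = ((\<Prod>i<a. 1 - fps_X ^ (k * i + l)) * (\<Prod>i<b. 1 - fps_X ^ (k * Suc i - l)))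
         * (1 - fps_X ^ (k * Suc b - l) :: rat fps)"
    by (simp only: prod.lessThan_Suc mult.assoc)
  then show ?case by (simp only: Suc.IH triple_product_left[OF assms])
qed


section \<open>The logarithmic derivative of the product\<close>

lemma X_deriv_one_minus_X_power:
  assumes "d > 0"
  shows "fps_X * fps_deriv (1 - fps_X ^ d) =
    - ((1 - fps_X ^ d) * Abs_fps (\<lambda>n. if 0 < n \<and> d dvd n then of_nat d else 0 :: rat))"
proof (rule fps_ext)
  fix n
  have "(fps_X * fps_deriv (1 - fps_X ^ d)) $ n = (if n = d then - of_nat d else 0 :: rat)"
    using assms by (cases n) auto
  moreover have "((1 - fps_X ^ d) * Abs_fps (\<lambda>n. if 0 < n \<and> d dvd n then of_nat d else 0)) $ n
      = (if n = d then of_nat d else 0 :: rat)"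
    using assms by (auto simp: left_diff_distrib fps_X_power_mult_nth dvd_diff_nat dest: dvd_imp_le)
      (metis dvd_diffD dvd_refl le_neq_implies_less linorder_not_less)+
  ultimately show "(fps_X * fps_deriv (1 - fps_X ^ d)) $ n =
    (- ((1 - fps_X ^ d) * Abs_fps (\<lambda>n. if 0 < n \<and> d dvd n then of_nat d else 0 :: rat))) $ n"
    by simp
qed

text \<open>The operator \<open>X * d/dX\<close> on a product of factors \<open>1 - X^d\<close>: its logarithmic derivative is the
  negative of the generating function of the sum of divisors that lie in \<open>S\<close>. The constant
  coefficient is set to \<open>0\<close> because every \<open>d\<close> divides \<open>0\<close>.\<close>

lemma X_deriv_prod_one_minus_X_power:
  assumes "finite S" "\<forall>d\<in>S. d > 0"
  shows "fps_X * fps_deriv (\<Prod>d\<in>S. 1 - fps_X ^ d) =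
    - ((\<Prod>d\<in>S. 1 - fps_X ^ d) *
       Abs_fps (\<lambda>n. if 0 < n then \<Sum>d | d \<in> S \<and> d dvd n. of_nat d else 0 :: rat))"
  using assms
proof (induction S rule: finite_induct)
  case empty
  show ?case by (simp add: fps_eq_iff)
next
  case (insert x S)
  define P where "P = (\<Prod>d\<in>S. 1 - fps_X ^ d :: rat fps)"
  define F where "F = (1 - fps_X ^ x :: rat fps)"
  define e where "e = Abs_fps (\<lambda>n. if 0 < n \<and> x dvd n then of_nat x else 0 :: rat)"
  define E where "E T = Abs_fps (\<lambda>n. if 0 < n then \<Sum>d | d \<in> T \<and> d dvd n. of_nat d else 0 :: rat)"
    for T
  have "E (insert x S) = e + E S"
  proof (rule fps_ext)
    fix n
    have "{d. d \<in> insert x S \<and> d dvd n} =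
        (if x dvd n then insert x {d. d \<in> S \<and> d dvd n} else {d. d \<in> S \<and> d dvd n})" by auto
    then show "E (insert x S) $ n = (e + E S) $ n"
      using insert.hyps by (simp add: E_def e_def)
  qed
  moreover have "fps_X * fps_deriv P = - (P * E S)"
    using insert unfolding P_def E_def by simp
  moreover have "fps_X * fps_deriv F = - (F * e)"
    unfolding F_def e_def by (rule X_deriv_one_minus_X_power) (use insert.prems in simp)
  moreover have "fps_X * fps_deriv (F * P) = (fps_X * fps_deriv F) * P + F * (fps_X * fps_deriv P)"
    by (simp add: algebra_simps)
  moreover have "(\<Prod>d\<in>insert x S. 1 - fps_X ^ d :: rat fps) = F * P"
    using insert.hyps by (simp add: F_def P_def)
  ultimately show ?case
    unfolding E_def[symmetric] by (simp only:) (simp add: algebra_simps)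
qed

text \<open>The elements of \<^const>\<open>Jbar\<close> up to \<open>k * m\<close>, that is, in the first \<open>m\<close> blocks of length \<open>k\<close>.\<close>

definition Jbar_upto :: "nat \<Rightarrow> nat \<Rightarrow> nat \<Rightarrow> nat set" where
  "Jbar_upto k l m = {d. d \<le> k * m \<and> int d \<in> Jbar k l}"

lemma finite_Jbar_upto: "finite (Jbar_upto k l m)"
  by (simp add: Jbar_upto_def)

lemma f_eq_sum_Jbar_upto:
  assumes "0 < n" "n \<le> k * m"
  shows "f k l (int n) = (\<Sum>d | d \<in> Jbar_upto k l m \<and> d dvd n. int d)"
proof -
  have "bij_betw int {d. d \<in> Jbar_upto k l m \<and> d dvd n} {d. d dvd int n \<and> d \<in> Jbar k l}"
  proof (rule bij_betw_imageI)
    show "int ` {d. d \<in> Jbar_upto k l m \<and> d dvd n} = {d. d dvd int n \<and> d \<in> Jbar k l}"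
    proof (intro equalityI subsetI)
      fix d assume d: "d \<in> {d. d dvd int n \<and> d \<in> Jbar k l}"
      then have "d > 0" by (simp add: Jbar_def)
      then obtain e where e: "d = int e" by (metis zero_less_imp_eq_int)
      with d have "e dvd n" by simp
      with assms have "e \<le> k * m" by (meson dvd_imp_le le_trans)
      with d e \<open>e dvd n\<close> show "d \<in> int ` {d. d \<in> Jbar_upto k l m \<and> d dvd n}" by (auto simp: Jbar_upto_def)
    qed (auto simp: Jbar_upto_def)
  qed simp
  then have "(\<Sum>d | d \<in> Jbar_upto k l m \<and> d dvd n. int d) = (\<Sum>d | d dvd int n \<and> d \<in> Jbar k l. d)"
    by (rule sum.reindex_bij_betw)
  then show ?thesis using assms by (simp add: f_def)
qed

lemma Jbar_upto_Suc:
  assumes "0 < l" "l < k"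
  shows "Jbar_upto k l (Suc m) = Jbar_upto k l m \<union> {k * m + l, k * Suc m - l, k * Suc m}"
proof (intro equalityI subsetI)
  fix d assume d: "d \<in> Jbar_upto k l (Suc m)"
  show "d \<in> Jbar_upto k l m \<union> {k * m + l, k * Suc m - l, k * Suc m}"
  proof (cases "d \<le> k * m")
    case False
    then obtain r where r: "d = k * m + r" "0 < r" by (metis less_imp_add_positive not_le)
    with d have rk: "r \<le> k" by (simp add: Jbar_upto_def)
    have "[int d = int r] (mod k)" by (simp add: r cong_def)
    then have "[int r = 0] (mod k) \<or> [int r = l] (mod k) \<or> [int r = - l] (mod k)"
      using d by (auto simp: Jbar_upto_def Jbar_def cong_def)
    then have "r = k \<or> r = l \<or> r = k - l"
    proof (elim disjE)
      assume "[int r = 0] (mod k)"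
      then have "k dvd r" by (simp add: cong_0_iff)
      with r rk show ?thesis by (auto dest: dvd_imp_le)
    next
      assume "[int r = l] (mod k)"
      then have "r mod k = l" using assms by (simp add: cong_def flip: of_nat_mod)
      with rk assms show ?thesis by (cases "r = k") auto
    next
      assume "[int r = - l] (mod k)"
      then have "int k dvd int (r + l)" by (simp add: cong_iff_dvd_diff)
      then have "k dvd r + l" by (simp only: of_nat_dvd_iff)
      then obtain c where c: "r + l = k * c" by (elim dvdE)
      with r rk assms have "0 < k * c" "k * c < k * 2" by linarith+
      then have "c = 1" by simp
      with c have "r = k - l" by simp
      then show ?thesis by simp
    qed
    then show ?thesis using assms r by auto
  qed (use d in \<open>auto simp: Jbar_upto_def\<close>)
next
  fix d assume "d \<in> Jbar_upto k l m \<union> {k * m + l, k * Suc m - l, k * Suc m}"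
  then consider "d \<in> Jbar_upto k l m" | "d = k * m + l" | "d = k * Suc m - l" | "d = k * Suc m" by blast
  then show "d \<in> Jbar_upto k l (Suc m)"
  proof cases
    case 1
    then show ?thesis by (auto simp: Jbar_upto_def)
  next
    case 2
    then show ?thesis using assms by (simp add: Jbar_upto_def Jbar_def cong_iff_dvd_diff)
  next
    case 3
    then have "int d = int k * int (Suc m) - int l" "0 < d"
      using assms by (simp_all add: of_nat_diff distrib_left)
    then show ?thesis using 3 by (simp add: Jbar_upto_def Jbar_def cong_iff_dvd_diff del: of_nat_Suc)
  next
    case 4
    then show ?thesis using assms by (simp add: Jbar_upto_def Jbar_def cong_iff_dvd_diff)
  qed
qed

text \<open>The hypothesis \<open>2 * l \<noteq> k\<close> makes the residues \<open>l\<close> and \<open>-l\<close> distinct, so that no factor on the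
  right is repeated.\<close>

lemma prod_Jbar_upto:
  assumes "0 < l" "l < k" "2 * l \<noteq> k"
  shows "(\<Prod>d\<in>Jbar_upto k l m. 1 - fps_X ^ d) =
    qfact k m * ((\<Prod>i<m. 1 - fps_X ^ (k * i + l)) * (\<Prod>i<m. 1 - fps_X ^ (k * Suc i - l)))"
proof (induction m)
  case 0
  have "Jbar_upto k l 0 = {}" by (auto simp: Jbar_upto_def Jbar_def)
  then show ?case by simp
next
  case (Suc m)
  define T where "T = {k * m + l, k * Suc m - l, k * Suc m}"
  have "Jbar_upto k l m \<inter> T = {}" using assms by (auto simp: Jbar_upto_def T_def)
  then have "(\<Prod>d\<in>Jbar_upto k l (Suc m). 1 - fps_X ^ d) = (\<Prod>d\<in>Jbar_upto k l m. 1 - fps_X ^ d) * (\<Prod>d\<in>T. 1 - fps_X ^ d :: rat fps)"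
    unfolding Jbar_upto_Suc[OF assms(1,2)] T_def[symmetric]
    by (intro prod.union_disjoint finite_Jbar_upto) (simp_all add: T_def)
  moreover have "k * m + l \<noteq> k * Suc m - l" "k * m + l \<noteq> k * Suc m" "k * Suc m - l \<noteq> k * Suc m"
    using assms by auto
  then have "(\<Prod>d\<in>T. 1 - fps_X ^ d) = (1 - fps_X ^ (k * m + l)) * ((1 - fps_X ^ (k * Suc m - l)) * (1 - fps_X ^ (k * Suc m)) :: rat fps)"
    unfolding T_def by (simp del: mult_Suc_right)
  ultimately show ?case
    by (simp only: Suc.IH qfact_Suc prod.lessThan_Suc ac_simps)
qed

section \<open>Comparison of coefficients\<close>

text \<open>The bound \<open>3 * n\<close> suffices: \<open>M j \<le> n\<close> implies \<open>\<bar>j\<bar> \<le> 2 * n\<close>, so the position \<open>3 * n + j\<close> of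
  the Gaussian binomial is at distance at least \<open>n\<close> from both ends of row \<open>6 * n\<close>.\<close>

lemma nth_prod_Jbar_upto:
  assumes "0 < l" "l < k" "2 * l \<noteq> k" "t \<le> n"
  shows "(\<Prod>d\<in>Jbar_upto k l (3 * n). 1 - fps_X ^ d :: rat fps) $ t =
    - of_int (\<Sum>j=-(3 * int n)..3 * int n. if M k l j = int t then alt_sign j else 0)"
proof -
  let ?m = "3 * n"
  let ?j = "\<lambda>i. int i - int ?m"
  have "(\<Prod>d\<in>Jbar_upto k l ?m. 1 - fps_X ^ d) =
      (\<Sum>i\<le>2 * ?m. theta k l (?j i) * (qfact k ?m * qbinomial k (2 * ?m) i))"
    unfolding prod_Jbar_upto[OF assms(1-3)] finite_triple_product[OF assms(1,2)]
    by (simp add: sum_distrib_left ac_simps del: sum.atMost_Suc flip: mult_2)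
  then have "(\<Prod>d\<in>Jbar_upto k l ?m. 1 - fps_X ^ d) $ t =
      (\<Sum>i\<le>2 * ?m. (theta k l (?j i) * (qfact k ?m * qbinomial k (2 * ?m) i)) $ t)"
    by (simp add: fps_sum_nth)
  also have "\<dots> = (\<Sum>i\<le>2 * ?m. of_int (- (if M k l (?j i) = int t then alt_sign (?j i) else 0)))"
  proof (rule sum.cong)
    fix i assume "i \<in> {..2 * ?m}"
    then have i: "i \<le> 2 * ?m" by simp
    define j where "j = ?j i"
    define c where "c = qfact k ?m * qbinomial k (2 * ?m) i"
    have M: "\<bar>j\<bar> \<le> 2 * M k l j" "0 \<le> M k l j" using M_ge[of l k j] M_nonneg[of l k j] assms by auto
    have th: "(theta k l j * c) $ t =
       of_int (- alt_sign j) * (if t < nat (M k l j) then 0 else c $ (t - nat (M k l j)))"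
      unfolding theta_def mult.assoc
      by (subst fps_of_int[symmetric]) (simp only: fps_mult_left_const_nth fps_X_power_mult_nth)
    show "(theta k l (?j i) * (qfact k ?m * qbinomial k (2 * ?m) i)) $ t =
        of_int (- (if M k l (?j i) = int t then alt_sign (?j i) else 0))"
    proof (cases "M k l j \<le> int t")
      case True
      with M assms have "\<bar>j\<bar> \<le> 2 * int n" by linarith
      then have "fps_X ^ Suc n dvd c - 1"
        unfolding c_def using assms i by (intro qfact_qbinomial_cong) (auto simp: j_def)
      then obtain r where "c = 1 + fps_X ^ Suc n * r" by (metis dvdE diff_eq_eq add.commute)
      then have "c $ s = (if s = 0 then 1 else 0)" if "s \<le> t" for s
        using that assms by (simp add: fps_X_power_mult_nth del: power_Suc)
      then show ?thesis using th True M
        unfolding c_def[symmetric] j_def[symmetric] by auto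
    next
      case False
      then show ?thesis using th unfolding c_def[symmetric] j_def[symmetric] by auto
    qed
  qed simp
  also have "\<dots> = (\<Sum>j=-int ?m..int ?m. of_int (- (if M k l j = int t then alt_sign j else 0)))"
    by (rule sum.reindex_bij_witness[where i = "\<lambda>j. nat (j + int ?m)" and j = ?j]) auto
  finally show ?thesis by (simp add: sum_negf)
qed

text \<open>The coefficient of \<open>X^n\<close> in \<open>X * A' = - A * F\<close>. The term \<open>j = 0\<close> is still part of the sum
  on the left.\<close>

lemma f_recurrence:
  fixes k l n :: nat
  assumes "0 < l" "l < k" "2 * l \<noteq> k" "0 < n"
  shows "(\<Sum>j=-(3 * int n)..3 * int n. alt_sign j * f k l (int n - M k l j))
      = - int n * (\<Sum>j=-(3 * int n)..3 * int n. if M k l j = int n then alt_sign j else 0)"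
proof -
  let ?J = "{-(3 * int n)..3 * int n}"
  define A where "A = (\<Prod>d\<in>Jbar_upto k l (3 * n). 1 - fps_X ^ d :: rat fps)"
  define E where "E = Abs_fps (\<lambda>n'. if 0 < n' then \<Sum>d | d \<in> Jbar_upto k l (3 * n) \<and> d dvd n'. of_nat d else 0 :: rat)"
  have A: "A $ t = - of_int (\<Sum>j\<in>?J. if M k l j = int t then alt_sign j else 0)" if "t \<le> n" for t
    unfolding A_def by (rule nth_prod_Jbar_upto[OF assms(1-3) that])
  have E: "E $ t = of_int (f k l (int t))" if "t \<le> n" for t
  proof (cases "t = 0")
    case False
    have "1 * (3 * n) \<le> k * (3 * n)" using assms by (intro mult_right_mono) auto
    with that have "t \<le> k * (3 * n)" by linarith
    with False show ?thesis by (simp add: E_def f_eq_sum_Jbar_upto)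
  qed (simp add: E_def f_def)
  have "fps_X * fps_deriv A = - (A * E)"
    unfolding A_def E_def
    by (rule X_deriv_prod_one_minus_X_power[OF finite_Jbar_upto]) (auto simp: Jbar_upto_def Jbar_def)
  then have "(fps_X * fps_deriv A) $ n = - (A * E) $ n" by simp
  moreover have "(fps_X * fps_deriv A) $ n = of_nat n * A $ n"
    using assms by (cases n) auto
  ultimately have "- (of_nat n * A $ n) = (\<Sum>t=0..n. A $ t * E $ (n - t))"
    by (simp add: fps_mult_nth)
  also have "\<dots> = (\<Sum>t=0..n. of_int (- (\<Sum>j\<in>?J. if M k l j = int t then alt_sign j else 0) * f k l (int n - int t)))"
    by (rule sum.cong) (simp_all add: A E of_nat_diff)
  finally have "of_int (int n * (\<Sum>j\<in>?J. if M k l j = int n then alt_sign j else 0)) =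
     (of_int (- (\<Sum>t=0..n. (\<Sum>j\<in>?J. if M k l j = int t then alt_sign j else 0) * f k l (int n - int t))) :: rat)"
    by (simp add: A sum_negf)
  then have "- int n * (\<Sum>j\<in>?J. if M k l j = int n then alt_sign j else 0) =
     (\<Sum>t=0..n. (\<Sum>j\<in>?J. if M k l j = int t then alt_sign j else 0) * f k l (int n - int t))"
    by (simp only: of_int_eq_iff)
  also have "\<dots> = (\<Sum>t=0..n. \<Sum>j\<in>?J. if M k l j = int t then alt_sign j * f k l (int n - M k l j) else 0)"
    unfolding sum_distrib_right by (intro sum.cong refl) auto
  also have "\<dots> = (\<Sum>j\<in>?J. \<Sum>t=0..n. if M k l j = int t then alt_sign j * f k l (int n - M k l j) else 0)"
    by (rule sum.swap)
  also have "\<dots> = (\<Sum>j\<in>?J. alt_sign j * f k l (int n - M k l j))"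
  proof (rule sum.cong)
    fix j
    \<comment> \<open>For \<open>M j > n\<close> both sides vanish, since \<open>f\<close> is \<open>0\<close> at negative arguments.\<close>
    have "0 \<le> M k l j" using assms by (intro M_nonneg) auto
    then obtain s where s: "M k l j = int s" by (metis nonneg_int_cases)
    show "(\<Sum>t=0..n. if M k l j = int t then alt_sign j * f k l (int n - M k l j) else 0)
        = alt_sign j * f k l (int n - M k l j)"
      by (simp add: s f_def)
  qed simp
  finally show ?thesis by simp
qed

theorem theorem3p7:
  fixes k l n :: int
  assumes "k \<ge> 3" and "0 < l" and "l < k" and "real_of_int l \<noteq> real_of_int k / 2"
    and "n > 0"
  shows "(\<forall>i. n = M k l i \<longrightarrow>
            f k l n = (\<Sum>\<^sub>\<infinity>j\<in>UNIV - {0}. alt_sign j * f k l (n - M k l j))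
                      + alt_sign i * M k l i)
       \<and> ((\<nexists>i. n = M k l i) \<longrightarrow>
            f k l n = (\<Sum>\<^sub>\<infinity>j\<in>UNIV - {0}. alt_sign j * f k l (n - M k l j)))"
proof -
  have kl: "2 * l \<noteq> k" using assms by auto
  let ?J = "{-(3 * n)..3 * n}"
  define R where "R = (\<Sum>j\<in>?J. if M k l j = n then alt_sign j else 0)"
  have "(\<Sum>j\<in>?J. alt_sign j * f k l (n - M k l j)) = - n * R"
    using f_recurrence[of "nat l" "nat k" "nat n"] assms kl by (simp add: R_def)
  moreover have "(\<Sum>j\<in>?J. alt_sign j * f k l (n - M k l j))
      = - f k l n + (\<Sum>j\<in>?J - {0}. alt_sign j * f k l (n - M k l j))"
    using assms by (subst sum.remove[of _ 0]) (auto simp: alt_sign_eq M_def)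
  moreover have "(\<Sum>\<^sub>\<infinity>j\<in>UNIV - {0}. alt_sign j * f k l (n - M k l j))
      = (\<Sum>\<^sub>\<infinity>j\<in>?J - {0}. alt_sign j * f k l (n - M k l j))"
  proof (rule infsum_cong_neutral)
    fix j assume "j \<in> (UNIV - {0}) - (?J - {0})"
    then have "n < \<bar>j\<bar> - n" using assms by auto
    with M_ge[of l k j] assms have "n \<le> M k l j" by linarith
    then show "alt_sign j * f k l (n - M k l j) = 0" by (simp add: f_def)
  qed auto
  ultimately have *: "f k l n = (\<Sum>\<^sub>\<infinity>j\<in>UNIV - {0}. alt_sign j * f k l (n - M k l j)) + n * R"
    by simp
  show ?thesis
  proof (intro conjI allI impI)
    fix i assume i: "n = M k l i"
    have "i \<in> ?J" using M_ge[of l k i] i assms by auto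
    moreover have "M k l j = n \<longleftrightarrow> j = i" for j
      using M_inj[of l k] assms kl unfolding i by (auto dest: injD)
    ultimately have "R = alt_sign i" by (simp add: R_def)
    with * i show "f k l n = (\<Sum>\<^sub>\<infinity>j\<in>UNIV - {0}. alt_sign j * f k l (n - M k l j))
        + alt_sign i * M k l i" by (simp add: mult.commute)
  next
    assume "\<nexists>i. n = M k l i"
    then have "R = 0" unfolding R_def by (intro sum.neutral) auto
    with * show "f k l n = (\<Sum>\<^sub>\<infinity>j\<in>UNIV - {0}. alt_sign j * f k l (n - M k l j))" by simp
  qed
qed

end
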